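(* Let $C_0>0$, let $K\ge0$ be a fixed integer, and let $\{\alpha_k\},\{\beta_k\},\{\gamma_k\}$ be the parameter sequences of algorithm $(\mathcal B')$ (defined in the context). There exists a constant $C>0$, depending only on $C_0$, $K$ and $\{\alpha_k\},\{\beta_k\},\{\gamma_k\}$, such that for all $L>0$, all $f\in\mathcal F^1_L$, all $x_0\in\mathbb R^n$ and all $0<s\le C_0/L$, the iterates of $(\mathcal B')$ satisfy $$s(f(x_K)-f^* )\le C\|x_0-x^*\|^2,\qquad s^2\|\nabla f(x_K)\|^2\le C\|x_0-x^*\|^2,\qquad\|z_{K+1}-x^*\|^2\le C\|x_0-x^*\|^2.$$
   Context: $\mathcal F^1_L$ is the set of continuously differentiable convex functions $f:\mathbb R^n\to\mathbb R$ that are $L$-smooth ($\|\nabla f(y)-\nabla f(x)\|\le L\|y-x\|$ for all $x,y$, Euclidean norm). It is assumed throughout that $f$ has a minimizer; $x^*$ denotes one of the minimizers and $f^*=f(x^* )$. Algorithm $(\mathcal B')$: given real sequences $\{\alpha_k\}_{k\ge0}$ (nonzero, so that the recursion is defined), $\{\beta_k\}_{k\ge0}$, $\{\gamma_k\}_{k\ge0}$, put $\widetilde\alpha_k=\beta_k\alpha_k+(\gamma_k-\beta_k)\alpha_{k+1}$; starting from $x_0=z_0\in\mathbb R^n$, for $k\ge0$, $$y_{k+1}=x_k-\beta_ks\nabla f(x_k),\qquad z_{k+1}=z_k-\widetilde\alpha_ks\nabla f(x_k),\qquad x_{k+1}=\frac1{\alpha_{k+1}}z_{k+1}+\Big(1-\frac1{\alpha_{k+1}}\Big)y_{k+1}.$$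 *)

theory Defs
  imports "HOL-Analysis.Analysis" "HOL-Library.Poly_Mapping"
begin

text \<open>
  The constant of the theorem must not depend on the dimension \<open>n\<close>, so \<open>n\<close> has to be quantified
  inside the formula and cannot be a type. All the spaces \<open>\<real>\<^sup>n\<close> are therefore realised inside one
  inner product space, the finitely supported real sequences \<open>nat \<Rightarrow>\<^sub>0 real\<close>: a vector of
  \<open>\<real>\<^sup>n\<close> is a sequence vanishing outside \<open>{..<n}\<close>, and norm and inner product are the
  Euclidean ones.
\<close>

instantiation poly_mapping :: (type, real_vector) real_vector
begin

lift_definition scaleR_poly_mapping :: "real \<Rightarrow> ('a \<Rightarrow>\<^sub>0 'b) \<Rightarrow> ('a \<Rightarrow>\<^sub>0 'b)"
  is "\<lambda>r x i. r *\<^sub>R x i"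
  by (erule finite_subset[rotated]) auto

instance
proof
  fix a b :: real and x y :: "'a \<Rightarrow>\<^sub>0 'b"
  show "a *\<^sub>R (x + y) = a *\<^sub>R x + a *\<^sub>R y"
    by (rule poly_mapping_eqI) (simp add: scaleR_poly_mapping.rep_eq lookup_add scaleR_add_right)
  show "(a + b) *\<^sub>R x = a *\<^sub>R x + b *\<^sub>R x"
    by (rule poly_mapping_eqI) (simp add: scaleR_poly_mapping.rep_eq lookup_add scaleR_add_left)
  show "a *\<^sub>R b *\<^sub>R x = (a * b) *\<^sub>R x"
    by (rule poly_mapping_eqI) (simp add: scaleR_poly_mapping.rep_eq)
  show "1 *\<^sub>R x = x"
    by (rule poly_mapping_eqI) (simp add: scaleR_poly_mapping.rep_eq)
qed

end

instantiation poly_mapping :: (type, real_inner) real_inner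
begin

definition inner_poly_mapping_def:
  "inner x y = (\<Sum>i\<in>Poly_Mapping.keys x. inner (Poly_Mapping.lookup x i) (Poly_Mapping.lookup y i))"

definition norm_poly_mapping_def:
  "norm x = sqrt (\<Sum>i\<in>Poly_Mapping.keys x. (norm (Poly_Mapping.lookup x i))\<^sup>2)"

definition sgn_poly_mapping_def:
  "sgn (x :: 'a \<Rightarrow>\<^sub>0 'b::real_inner) = x /\<^sub>R norm x"

definition dist_poly_mapping_def:
  "dist (x :: 'a \<Rightarrow>\<^sub>0 'b::real_inner) y = norm (x - y)"

definition uniformity_poly_mapping_def [code del]:
  "(uniformity :: (('a \<Rightarrow>\<^sub>0 'b::real_inner) \<times> ('a \<Rightarrow>\<^sub>0 'b::real_inner)) filter) =
     (INF e\<in>{0 <..}. principal {(x, y). dist x y < e})"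

definition open_poly_mapping_def [code del]:
  "open (U :: ('a \<Rightarrow>\<^sub>0 'b::real_inner) set) \<longleftrightarrow>
     (\<forall>x\<in>U. eventually (\<lambda>(x', y). x' = x \<longrightarrow> y \<in> U) uniformity)"

lemma inner_poly_mapping_superset:
  fixes x y :: "'a \<Rightarrow>\<^sub>0 'b::real_inner"
  assumes "finite A" "Poly_Mapping.keys x \<subseteq> A"
  shows "inner x y = (\<Sum>i\<in>A. inner (Poly_Mapping.lookup x i) (Poly_Mapping.lookup y i))"
  unfolding inner_poly_mapping_def
  by (rule sum.mono_neutral_left) (use assms in \<open>auto simp: in_keys_iff\<close>)

instance
proof
  fix a :: real and x y z :: "'a \<Rightarrow>\<^sub>0 'b::real_inner"
  show "inner x y = inner y x"
    using inner_poly_mapping_superset[of "Poly_Mapping.keys x \<union> Poly_Mapping.keys y" x y]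
      inner_poly_mapping_superset[of "Poly_Mapping.keys x \<union> Poly_Mapping.keys y" y x]
    by (simp add: inner_commute)
  show "inner (x + y) z = inner x z + inner y z"
    using inner_poly_mapping_superset[of "Poly_Mapping.keys x \<union> Poly_Mapping.keys y" x z]
      inner_poly_mapping_superset[of "Poly_Mapping.keys x \<union> Poly_Mapping.keys y" y z]
      inner_poly_mapping_superset[of "Poly_Mapping.keys x \<union> Poly_Mapping.keys y" "x + y" z] keys_add[of x y]
    by (simp add: lookup_add inner_add_left sum.distrib)
  have "Poly_Mapping.keys (a *\<^sub>R x) \<subseteq> Poly_Mapping.keys x"
    by (auto simp: in_keys_iff scaleR_poly_mapping.rep_eq)
  then show "inner (a *\<^sub>R x) y = a * inner x y"
    using inner_poly_mapping_superset[of "Poly_Mapping.keys x" "a *\<^sub>R x" y]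
    by (simp add: scaleR_poly_mapping.rep_eq inner_poly_mapping_def sum_distrib_left)
  show "0 \<le> inner x x"
    by (simp add: inner_poly_mapping_def sum_nonneg)
  show "inner x x = 0 \<longleftrightarrow> x = 0"
    by (auto simp: inner_poly_mapping_def sum_nonneg_eq_0_iff in_keys_iff intro!: poly_mapping_eqI)
qed (simp_all add: norm_poly_mapping_def inner_poly_mapping_def power2_norm_eq_inner sgn_poly_mapping_def dist_poly_mapping_def
      uniformity_poly_mapping_def open_poly_mapping_def)

end

definition Rn :: "nat \<Rightarrow> (nat \<Rightarrow>\<^sub>0 real) set" where
  "Rn n = {x. Poly_Mapping.keys x \<subseteq> {..<n}}"

lemma norm_Rn:
  assumes "x \<in> Rn n"
  shows "norm x = sqrt (\<Sum>i<n. (Poly_Mapping.lookup x i)\<^sup>2)"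
  using inner_poly_mapping_superset[of "{..<n}" x x] assms
  by (simp add: Rn_def norm_eq_sqrt_inner power2_eq_square)

lemma subspace_Rn: "subspace (Rn n)"
  unfolding subspace_def Rn_def
  by (auto simp: in_keys_iff lookup_add scaleR_poly_mapping.rep_eq subset_iff)
    (metis add_0)

text \<open>
  A function on \<open>\<real>\<^sup>n\<close> is represented by a function on the ambient space of which only the
  restriction to \<open>Rn n\<close> matters; accordingly derivatives are taken within \<open>Rn n\<close>
  and the gradient has to lie in \<open>Rn n\<close>, which makes it unique.
\<close>

definition has_gradient ::
    "nat \<Rightarrow> ((nat \<Rightarrow>\<^sub>0 real) \<Rightarrow> real) \<Rightarrow> (nat \<Rightarrow>\<^sub>0 real) \<Rightarrow> (nat \<Rightarrow>\<^sub>0 real) \<Rightarrow> bool" where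
  "has_gradient n f x g \<longleftrightarrow>
     g \<in> Rn n \<and> (f has_derivative (\<lambda>h. inner h g)) (at x within Rn n)"

definition grad :: "nat \<Rightarrow> ((nat \<Rightarrow>\<^sub>0 real) \<Rightarrow> real) \<Rightarrow> (nat \<Rightarrow>\<^sub>0 real) \<Rightarrow> (nat \<Rightarrow>\<^sub>0 real)" where
  "grad n f x = (THE g. has_gradient n f x g)"

lemma has_gradient_unique:
  assumes x: "x \<in> Rn n" and 1: "has_gradient n f x g" and 2: "has_gradient n f x g'"
  shows "g = g'"
proof -
  define d where "d = g - g'"
  have d: "d \<in> Rn n"
    using 1 2 subspace_diff[OF subspace_Rn] unfolding has_gradient_def d_def by blast
  define p where "p = (\<lambda>t::real. x + t *\<^sub>R d)"
  have p: "p t \<in> Rn n" for t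
    unfolding p_def by (intro subspace_add[OF subspace_Rn] subspace_scale[OF subspace_Rn] x d)
  have pd: "(p has_derivative (\<lambda>t. t *\<^sub>R d)) (at 0)"
    unfolding p_def by (auto intro!: derivative_eq_intros)
  have *: "((\<lambda>t. f (p t)) has_derivative (\<lambda>t. inner (t *\<^sub>R d) k)) (at 0)"
    if "has_gradient n f x k" for k
  proof -
    have "(f has_derivative (\<lambda>h. inner h k)) (at (p 0) within range p)"
      using that p unfolding has_gradient_def p_def
      by (auto intro: has_derivative_subset)
    then show ?thesis
      using diff_chain_within[OF pd, of f "\<lambda>h. inner h k"] by (simp add: o_def)
  qed
  have "(\<lambda>t. inner (t *\<^sub>R d) g) = (\<lambda>t. inner (t *\<^sub>R d) g')"
    by (rule has_derivative_unique[OF *[OF 1] *[OF 2]])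
  from fun_cong[OF this, of 1] have "inner d d = 0"
    by (simp add: d_def inner_diff_right)
  then show ?thesis by (simp add: d_def)
qed

lemma grad_eq: "x \<in> Rn n \<Longrightarrow> has_gradient n f x g \<Longrightarrow> grad n f x = g"
  unfolding grad_def by (blast intro: has_gradient_unique)

definition smooth_convex :: "nat \<Rightarrow> real \<Rightarrow> ((nat \<Rightarrow>\<^sub>0 real) \<Rightarrow> real) set" where
  "smooth_convex n L = {f. convex_on (Rn n) f \<and>
     (\<forall>x\<in>Rn n. \<exists>g. has_gradient n f x g) \<and>
     continuous_on (Rn n) (grad n f) \<and>
     (\<forall>x\<in>Rn n. \<forall>y\<in>Rn n. norm (grad n f y - grad n f x) \<le> L * norm (y - x))}"

definition minimizer :: "nat \<Rightarrow> ((nat \<Rightarrow>\<^sub>0 real) \<Rightarrow> real) \<Rightarrow> (nat \<Rightarrow>\<^sub>0 real) \<Rightarrow> bool" where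
  "minimizer n f xs \<longleftrightarrow> xs \<in> Rn n \<and> (\<forall>x\<in>Rn n. f xs \<le> f x)"

definition alpha_tilde :: "(nat \<Rightarrow> real) \<Rightarrow> (nat \<Rightarrow> real) \<Rightarrow> (nat \<Rightarrow> real) \<Rightarrow> nat \<Rightarrow> real" where
  "alpha_tilde \<alpha> \<beta> \<gamma> k = \<beta> k * \<alpha> k + (\<gamma> k - \<beta> k) * \<alpha> (Suc k)"

text \<open>
  The sequences \<open>x\<close>, \<open>y\<close>, \<open>z\<close> are the iterates started at \<open>x0\<close>; the
  algorithm defines no \<open>y 0\<close>, which is left arbitrary.
\<close>

definition iterates_B' ::
    "(nat \<Rightarrow> real) \<Rightarrow> (nat \<Rightarrow> real) \<Rightarrow> (nat \<Rightarrow> real) \<Rightarrow> nat \<Rightarrow> ((nat \<Rightarrow>\<^sub>0 real) \<Rightarrow> real) \<Rightarrow> real \<Rightarrow>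
     (nat \<Rightarrow>\<^sub>0 real) \<Rightarrow> (nat \<Rightarrow> (nat \<Rightarrow>\<^sub>0 real)) \<Rightarrow> (nat \<Rightarrow> (nat \<Rightarrow>\<^sub>0 real)) \<Rightarrow>
     (nat \<Rightarrow> (nat \<Rightarrow>\<^sub>0 real)) \<Rightarrow> bool" where
  "iterates_B' \<alpha> \<beta> \<gamma> n f s x0 x y z \<longleftrightarrow>
     x 0 = x0 \<and> z 0 = x0 \<and>
     (\<forall>k. y (Suc k) = x k - (\<beta> k * s) *\<^sub>R grad n f (x k) \<and>
          z (Suc k) = z k - (alpha_tilde \<alpha> \<beta> \<gamma> k * s) *\<^sub>R grad n f (x k) \<and>
          x (Suc k) = (1 / \<alpha> (Suc k)) *\<^sub>R z (Suc k) + (1 - 1 / \<alpha> (Suc k)) *\<^sub>R y (Suc k))"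

end

theory Submission
  imports Defs
begin

text \<open>
  Since the gradient vanishes at the minimizer, smoothness and \<open>s \<le> C0 / L\<close> give
  \<open>s * norm (grad n f u) \<le> C0 * norm (u - xs)\<close> for every \<open>u\<close>. Hence one step of the algorithm
  enlarges the distances of \<open>x\<close> and \<open>z\<close> to the minimizer by at most a factor determined by
  \<open>C0\<close> and the parameters, and the mean value theorem bounds the gap of function values
  at \<open>u\<close> by \<open>L * (norm (u - xs))\<^sup>2\<close>.
\<close>

lemma has_gradient_grad:
  assumes "f \<in> smooth_convex n L" "x \<in> Rn n"
  shows "has_gradient n f x (grad n f x)"
  using assms grad_eq unfolding smooth_convex_def by blast

lemma grad_in_Rn: "f \<in> smooth_convex n L \<Longrightarrow> x \<in> Rn n \<Longrightarrow> grad n f x \<in> Rn n"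
  using has_gradient_grad unfolding has_gradient_def by blast

lemma has_gradient_line:
  assumes x: "x \<in> Rn n" and d: "d \<in> Rn n" and g: "has_gradient n f (x + t *\<^sub>R d) g"
  shows "((\<lambda>t. f (x + t *\<^sub>R d)) has_field_derivative inner d g) (at t)"
proof -
  define p where "p = (\<lambda>t::real. x + t *\<^sub>R d)"
  have "range p \<subseteq> Rn n"
    unfolding p_def by (auto intro!: subspace_add[OF subspace_Rn] subspace_scale[OF subspace_Rn] x d)
  then have "(f has_derivative (\<lambda>h. inner h g)) (at (p t) within range p)"
    using g unfolding has_gradient_def p_def by (auto intro: has_derivative_subset)
  moreover have "(p has_derivative (\<lambda>h. h *\<^sub>R d)) (at t)"
    unfolding p_def by (auto intro!: derivative_eq_intros)
  ultimately have "((\<lambda>t. f (p t)) has_derivative (\<lambda>h. inner (h *\<^sub>R d) g)) (at t)"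
    using diff_chain_within[of p "\<lambda>h. h *\<^sub>R d" t UNIV f "\<lambda>h. inner h g"] by (simp add: o_def)
  then show ?thesis
    by (simp add: has_field_derivative_def p_def mult.commute[of _ "inner d g"])
qed

lemma grad_minimizer:
  assumes f: "f \<in> smooth_convex n L" and m: "minimizer n f xs"
  shows "grad n f xs = 0"
proof -
  let ?g = "grad n f xs"
  have xs: "xs \<in> Rn n" using m by (simp add: minimizer_def)
  have g: "?g \<in> Rn n" by (rule grad_in_Rn[OF f xs])
  have "((\<lambda>t. f (xs + t *\<^sub>R ?g)) has_field_derivative inner ?g ?g) (at 0)"
    by (rule has_gradient_line[OF xs g]) (simp add: has_gradient_grad[OF f xs])
  moreover have "f xs \<le> f (xs + t *\<^sub>R ?g)" for t
    using m xs g unfolding minimizer_def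
    by (auto intro!: subspace_add[OF subspace_Rn] subspace_scale[OF subspace_Rn])
  ultimately have "inner ?g ?g = 0"
    by (intro DERIV_local_min[where d = 1]) auto
  then show ?thesis by simp
qed

lemma norm_grad_le:
  assumes f: "f \<in> smooth_convex n L" and m: "minimizer n f xs" and u: "u \<in> Rn n"
  shows "norm (grad n f u) \<le> L * norm (u - xs)"
proof -
  have "norm (grad n f u - grad n f xs) \<le> L * norm (u - xs)"
    using f m u unfolding smooth_convex_def minimizer_def by blast
  then show ?thesis by (simp add: grad_minimizer[OF f m])
qed

lemma minimizer_gap_le:
  assumes L: "L > 0" and f: "f \<in> smooth_convex n L" and m: "minimizer n f xs" and u: "u \<in> Rn n"
  shows "f u - f xs \<le> L * (norm (u - xs))\<^sup>2"
proof -
  let ?d = "u - xs"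
  define p where "p t = xs + t *\<^sub>R ?d" for t :: real
  have xs: "xs \<in> Rn n" using m by (simp add: minimizer_def)
  have d: "?d \<in> Rn n" by (rule subspace_diff[OF subspace_Rn u xs])
  have p: "p t \<in> Rn n" for t
    unfolding p_def by (intro subspace_add[OF subspace_Rn] subspace_scale[OF subspace_Rn] xs d)
  have der: "((\<lambda>t. f (p t)) has_field_derivative inner ?d (grad n f (p t))) (at t)" for t
    using has_gradient_line[OF xs d] has_gradient_grad[OF f p] unfolding p_def by blast
  obtain t where t: "0 < t" "t < 1" "f (p 1) - f (p 0) = (1 - 0) * inner ?d (grad n f (p t))"
    using MVT2[of 0 1 "\<lambda>t. f (p t)" "\<lambda>t. inner ?d (grad n f (p t))"] der by auto
  have "norm (grad n f (p t)) \<le> L * norm (p t - xs)"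
    by (rule norm_grad_le[OF f m p])
  also have "\<dots> \<le> L * norm ?d"
    using t L by (simp add: p_def mult_left_le_one_le)
  finally have "norm ?d * norm (grad n f (p t)) \<le> norm ?d * (L * norm ?d)"
    by (simp add: mult_left_mono)
  then have "inner ?d (grad n f (p t)) \<le> norm ?d * (L * norm ?d)"
    by (rule order_trans[OF norm_cauchy_schwarz])
  then show ?thesis using t(3) by (simp add: p_def power2_eq_square algebra_simps)
qed

lemma gradient_step_bound:
  assumes f: "f \<in> smooth_convex n L" and m: "minimizer n f xs" and u: "u \<in> Rn n" and L: "L > 0"
    and s: "0 < s" "s \<le> C0 / L"
  shows "s * norm (grad n f u) \<le> C0 * norm (u - xs)"
proof -
  have "s * norm (grad n f u) \<le> s * (L * norm (u - xs))"
    using norm_grad_le[OF f m u] s by (simp add: mult_left_mono)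
  also have "\<dots> \<le> C0 * norm (u - xs)"
    using s L by (simp add: mult.assoc[symmetric] mult_right_mono pos_le_divide_eq)
  finally show ?thesis .
qed

lemma iterates_B'_bounded:
  fixes C0 :: real
  assumes "C0 > 0"
  shows "\<exists>R>0. \<forall>n L f xs x0 s x y z.
    L > 0 \<and> f \<in> smooth_convex n L \<and> minimizer n f xs \<and> x0 \<in> Rn n \<and> 0 < s \<and> s \<le> C0 / L \<and>
    iterates_B' \<alpha> \<beta> \<gamma> n f s x0 x y z \<longrightarrow>
      x k \<in> Rn n \<and> z k \<in> Rn n \<and>
      norm (x k - xs) \<le> R * norm (x0 - xs) \<and> norm (z k - xs) \<le> R * norm (x0 - xs)"
proof (induction k)
  case 0
  show ?case by (rule exI[of _ 1]) (auto simp: iterates_B'_def)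
next
  case (Suc k)
  then obtain R where R: "R > 0" and IH: "\<And>n L f xs x0 s x y z.
    L > 0 \<Longrightarrow> f \<in> smooth_convex n L \<Longrightarrow> minimizer n f xs \<Longrightarrow> x0 \<in> Rn n \<Longrightarrow> 0 < s \<Longrightarrow> s \<le> C0 / L \<Longrightarrow>
    iterates_B' \<alpha> \<beta> \<gamma> n f s x0 x y z \<Longrightarrow>
      x k \<in> Rn n \<and> z k \<in> Rn n \<and>
      norm (x k - xs) \<le> R * norm (x0 - xs) \<and> norm (z k - xs) \<le> R * norm (x0 - xs)"
    by blast
  define A where "A = alpha_tilde \<alpha> \<beta> \<gamma> k"
  define a where "a = 1 / \<alpha> (Suc k)"
  define Ry where "Ry = (1 + \<bar>\<beta> k\<bar> * C0) * R"
  define Rz where "Rz = (1 + \<bar>A\<bar> * C0) * R"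
  define Rx where "Rx = \<bar>a\<bar> * Rz + \<bar>1 - a\<bar> * Ry"
  have pos: "Rz > 0" "Ry > 0"
    using R assms by (auto simp: Rz_def Ry_def intro!: mult_pos_pos add_pos_nonneg)
  then have pos': "Rx \<ge> 0" by (simp add: Rx_def)
  with pos have sum_pos: "Rx + Rz > 0" by simp
  show ?case
  proof (intro exI[of _ "Rx + Rz"] conjI[OF sum_pos] allI impI, goal_cases)
    case (1 n L f xs x0 s x y z)
    let ?D = "norm (x0 - xs)" and ?g = "grad n f (x k)"
    have f: "f \<in> smooth_convex n L" and it: "iterates_B' \<alpha> \<beta> \<gamma> n f s x0 x y z" and s: "0 < s"
      using 1 by auto
    from 1 IH have k: "x k \<in> Rn n" "z k \<in> Rn n"
      "norm (x k - xs) \<le> R * ?D" "norm (z k - xs) \<le> R * ?D"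
      by blast+
    have y: "y (Suc k) = x k - (\<beta> k * s) *\<^sub>R ?g"
      and z: "z (Suc k) = z k - (A * s) *\<^sub>R ?g"
      and x: "x (Suc k) = a *\<^sub>R z (Suc k) + (1 - a) *\<^sub>R y (Suc k)"
      using it unfolding iterates_B'_def A_def a_def by auto
    have g: "?g \<in> Rn n" by (rule grad_in_Rn[OF f k(1)])
    have "s * norm ?g \<le> C0 * norm (x k - xs)"
      using gradient_step_bound k(1) 1 by blast
    also have "\<dots> \<le> C0 * (R * ?D)"
      using k(3) assms by simp
    finally have sg: "s * norm ?g \<le> C0 * (R * ?D)" .
    have step: "norm (v - (c * s) *\<^sub>R ?g - xs) \<le> (1 + \<bar>c\<bar> * C0) * R * ?D"
      if "norm (v - xs) \<le> R * ?D" for v c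
    proof -
      have "norm (v - (c * s) *\<^sub>R ?g - xs) \<le> norm (v - xs) + norm ((c * s) *\<^sub>R ?g)"
        using norm_triangle_ineq4[of "v - xs" "(c * s) *\<^sub>R ?g"] by (simp add: algebra_simps)
      also have "\<dots> = norm (v - xs) + \<bar>c\<bar> * (s * norm ?g)"
        using s by (simp add: abs_mult)
      also have "\<dots> \<le> R * ?D + \<bar>c\<bar> * (C0 * (R * ?D))"
        using that sg by (intro add_mono mult_left_mono) auto
      finally show ?thesis by (simp add: algebra_simps)
    qed
    have nz: "norm (z (Suc k) - xs) \<le> Rz * ?D"
      unfolding z Rz_def by (rule step[OF k(4)])
    have ny: "norm (y (Suc k) - xs) \<le> Ry * ?D"
      unfolding y Ry_def by (rule step[OF k(3)])
    have "x (Suc k) - xs = a *\<^sub>R (z (Suc k) - xs) + (1 - a) *\<^sub>R (y (Suc k) - xs)"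
      unfolding x by (simp add: algebra_simps)
    also have "norm \<dots> \<le> \<bar>a\<bar> * norm (z (Suc k) - xs) + \<bar>1 - a\<bar> * norm (y (Suc k) - xs)"
      by (rule order_trans[OF norm_triangle_ineq]) simp
    also have "\<dots> \<le> \<bar>a\<bar> * (Rz * ?D) + \<bar>1 - a\<bar> * (Ry * ?D)"
      using nz ny by (intro add_mono mult_left_mono) auto
    finally have nx: "norm (x (Suc k) - xs) \<le> Rx * ?D"
      by (simp add: Rx_def algebra_simps)
    have zR: "z (Suc k) \<in> Rn n" and yR: "y (Suc k) \<in> Rn n"
      unfolding y z
      by (intro subspace_diff[OF subspace_Rn] subspace_scale[OF subspace_Rn] k g)+
    have xR: "x (Suc k) \<in> Rn n"
      unfolding x by (intro subspace_add[OF subspace_Rn] subspace_scale[OF subspace_Rn] zR yR)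
    have "Rx * ?D \<le> (Rx + Rz) * ?D" "Rz * ?D \<le> (Rx + Rz) * ?D"
      using pos pos' by (auto intro!: mult_right_mono)
    with nx nz xR zR show ?case by linarith
  qed
qed

theorem lemmaS3:
  fixes C0 :: real and K :: nat and \<alpha> \<beta> \<gamma> :: "nat \<Rightarrow> real"
  assumes "C0 > 0" and "\<forall>k. \<alpha> k \<noteq> 0"
  shows "\<exists>C>0. \<forall>n. \<forall>L>0. \<forall>f\<in>smooth_convex n L. \<forall>xs. minimizer n f xs \<longrightarrow>
    (\<forall>x0\<in>Rn n. \<forall>s. 0 < s \<and> s \<le> C0 / L \<longrightarrow>
      (\<forall>x y z. iterates_B' \<alpha> \<beta> \<gamma> n f s x0 x y z \<longrightarrow>
        s * (f (x K) - f xs) \<le> C * (norm (x0 - xs))\<^sup>2 \<and>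
        s\<^sup>2 * (norm (grad n f (x K)))\<^sup>2 \<le> C * (norm (x0 - xs))\<^sup>2 \<and>
        (norm (z (Suc K) - xs))\<^sup>2 \<le> C * (norm (x0 - xs))\<^sup>2))"
proof -
  obtain R where R: "R > 0" and bK: "\<And>n L f xs x0 s x y z.
    L > 0 \<Longrightarrow> f \<in> smooth_convex n L \<Longrightarrow> minimizer n f xs \<Longrightarrow> x0 \<in> Rn n \<Longrightarrow> 0 < s \<Longrightarrow> s \<le> C0 / L \<Longrightarrow>
    iterates_B' \<alpha> \<beta> \<gamma> n f s x0 x y z \<Longrightarrow> x K \<in> Rn n \<and> norm (x K - xs) \<le> R * norm (x0 - xs)"
    using iterates_B'_bounded[OF assms(1), of \<alpha> \<beta> \<gamma> K] by blast
  obtain R' where R': "R' > 0" and bSK: "\<And>n L f xs x0 s x y z.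
    L > 0 \<Longrightarrow> f \<in> smooth_convex n L \<Longrightarrow> minimizer n f xs \<Longrightarrow> x0 \<in> Rn n \<Longrightarrow> 0 < s \<Longrightarrow> s \<le> C0 / L \<Longrightarrow>
    iterates_B' \<alpha> \<beta> \<gamma> n f s x0 x y z \<Longrightarrow> norm (z (Suc K) - xs) \<le> R' * norm (x0 - xs)"
    using iterates_B'_bounded[OF assms(1), of \<alpha> \<beta> \<gamma> "Suc K"] by blast
  define C where "C = C0 * R\<^sup>2 + (C0 * R)\<^sup>2 + R'\<^sup>2"
  have C_pos: "C > 0"
    using R' assms(1) by (auto simp: C_def intro!: add_nonneg_pos)
  have C_ge: "C0 * R\<^sup>2 \<le> C" "(C0 * R)\<^sup>2 \<le> C" "R'\<^sup>2 \<le> C"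
    using assms(1) by (auto simp: C_def)
  show ?thesis
  proof (intro exI[of _ C] conjI[OF C_pos] allI ballI impI, elim conjE)
    fix n L f xs x0 s x y z
    assume L: "L > 0" and f: "f \<in> smooth_convex n L" and m: "minimizer n f xs" and x0: "x0 \<in> Rn n"
      and s: "0 < s" "s \<le> C0 / L" and it: "iterates_B' \<alpha> \<beta> \<gamma> n f s x0 x y z"
    let ?D = "norm (x0 - xs)" and ?d = "norm (x K - xs)"
    have xK: "x K \<in> Rn n" and d: "?d \<le> R * ?D"
      using bK[OF L f m x0 s it] by auto
    have d2: "?d\<^sup>2 \<le> R\<^sup>2 * ?D\<^sup>2"
      using power_mono[OF d, of 2] by (simp add: power_mult_distrib)
    have "s * (f (x K) - f xs) \<le> s * (L * ?d\<^sup>2)"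
      using minimizer_gap_le[OF L f m xK] s by (simp add: mult_left_mono)
    also have "\<dots> \<le> C0 * ?d\<^sup>2"
      using s L by (simp add: mult.assoc[symmetric] mult_right_mono pos_le_divide_eq)
    also have "\<dots> \<le> C0 * R\<^sup>2 * ?D\<^sup>2"
      using d2 assms(1) by (simp add: mult.assoc)
    also have "\<dots> \<le> C * ?D\<^sup>2"
      by (rule mult_right_mono[OF C_ge(1)]) simp
    finally have 1: "s * (f (x K) - f xs) \<le> C * ?D\<^sup>2" .
    have "s * norm (grad n f (x K)) \<le> C0 * ?d"
      by (rule gradient_step_bound[OF f m xK L s])
    also have "\<dots> \<le> C0 * R * ?D"
      using d assms(1) by (simp add: mult.assoc)
    finally have "(s * norm (grad n f (x K)))\<^sup>2 \<le> (C0 * R * ?D)\<^sup>2"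
      using s by (intro power_mono) auto
    then have "s\<^sup>2 * (norm (grad n f (x K)))\<^sup>2 \<le> (C0 * R)\<^sup>2 * ?D\<^sup>2"
      by (simp add: power_mult_distrib)
    also have "\<dots> \<le> C * ?D\<^sup>2"
      by (rule mult_right_mono[OF C_ge(2)]) simp
    finally have 2: "s\<^sup>2 * (norm (grad n f (x K)))\<^sup>2 \<le> C * ?D\<^sup>2" .
    have "(norm (z (Suc K) - xs))\<^sup>2 \<le> (R' * ?D)\<^sup>2"
      using bSK[OF L f m x0 s it] by (rule power_mono) simp
    also have "\<dots> = R'\<^sup>2 * ?D\<^sup>2"
      by (simp add: power_mult_distrib)
    also have "\<dots> \<le> C * ?D\<^sup>2"
      by (rule mult_right_mono[OF C_ge(3)]) simp
    finally show "s * (f (x K) - f xs) \<le> C * ?D\<^sup>2 \<and>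
        s\<^sup>2 * (norm (grad n f (x K)))\<^sup>2 \<le> C * ?D\<^sup>2 \<and> (norm (z (Suc K) - xs))\<^sup>2 \<le> C * ?D\<^sup>2"
      using 1 2 by blast
  qed
qed

end
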